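(* Let $p$ be a prime number and let $d\ge p-1$ be an integer. If $A\subset\mathbb Z^d$ is a set of $p$ points in general linear positions, then $A$ is both tiling and spectral in $\mathbb Z^d$.
   Context: A set of $p$ points in $\mathbb Z^d$ is in general linear positions if the points are not contained in any hyperplane or affine hyperplane (linear or affine subspace) of dimension $p-2$; equivalently, if one fixes any one of the $p$ points, then the $p-1$ vectors from the fixed point to the other $p-1$ points are linearly independent. Let $G$ be a finitely generated Abelian group and $A\subseteq G$. The set $A$ is tiling in $G$ if there exists $B\subseteq G$ such that the translates $\{A+b\}_{b\in B}$ form a partition of $G$. The set $A$ is spectral in $G$ if there exists a set $S$ of group characters of $G$ (homomorphisms from $G$ to the unit circle in $\mathbb C$) whose restrictions to $A$ form an orthogonal basis of $L^2(A)$, where $A$ carries the counting measure; distinct elements of $S$ give distinct basis elements, so $|S|=|A|$ for finite $A$. *)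

theory Defs
  imports "HOL-Analysis.Analysis" "HOL-Library.Disjoint_Sets"
begin

definition real_vec :: "int ^ 'd \<Rightarrow> real ^ 'd" where
  "real_vec v = (\<chi> i. real_of_int (v $ i))"

text \<open>
  Affine subspaces are taken in the real space containing the lattice; they include the linear
  subspaces, for which \<^const>\<open>aff_dim\<close> is the linear dimension. If the set has more than
  \<open>d + 1\<close> elements there may be no subspace of the required dimension, so the notion is only
  meaningful for sets of at most \<open>d + 1\<close> points; for these it agrees with linear independence
  of difference vectors, see \<open>general_linear_position_iff_independent\<close>.
\<close>

definition general_linear_position :: "(int ^ 'd) set \<Rightarrow> bool" where
  "general_linear_position A \<longleftrightarrow>
     \<not> (\<exists>H :: (real ^ 'd) set. affine H \<and> aff_dim H = int (card A) - 2 \<and> real_vec ` A \<subseteq> H)"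

definition tiling :: "'a::ab_group_add set \<Rightarrow> bool" where
  "tiling A \<longleftrightarrow>
     (\<exists>B. disjoint_family_on (\<lambda>b. (\<lambda>a. a + b) ` A) B \<and> (\<Union>b\<in>B. (\<lambda>a. a + b) ` A) = UNIV)"

definition group_character :: "('a::ab_group_add \<Rightarrow> complex) \<Rightarrow> bool" where
  "group_character h \<longleftrightarrow> (\<forall>x. h x \<in> sphere 0 1) \<and> (\<forall>x y. h (x + y) = h x * h y)"

text \<open>
  Elements of \<open>L\<^sup>2(A)\<close> are represented by extensional functions, so that equality of
  representatives is equality on \<open>A\<close> (no nonempty set is null for the counting measure).
\<close>

definition L2 :: "'a set \<Rightarrow> ('a \<Rightarrow> complex) set" where
  "L2 A = {f \<in> extensional A. integrable (count_space A) (\<lambda>x. (norm (f x))\<^sup>2)}"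

definition L2_inner :: "'a set \<Rightarrow> ('a \<Rightarrow> complex) \<Rightarrow> ('a \<Rightarrow> complex) \<Rightarrow> complex" where
  "L2_inner A f g = (LINT x|count_space A. f x * cnj (g x))"

definition L2_norm :: "'a set \<Rightarrow> ('a \<Rightarrow> complex) \<Rightarrow> real" where
  "L2_norm A f = sqrt (LINT x|count_space A. (norm (f x))\<^sup>2)"

text \<open>
  Basis in the Hilbert space sense: the linear span is dense. For finite \<open>A\<close> the space is
  finite-dimensional, so the span is then all of \<open>L\<^sup>2(A)\<close>.
\<close>

definition orthogonal_basis :: "'a set \<Rightarrow> ('a \<Rightarrow> complex) set \<Rightarrow> bool" where
  "orthogonal_basis A E \<longleftrightarrow>
     E \<subseteq> L2 A \<and> (\<forall>e\<in>E. L2_norm A e \<noteq> 0) \<and> pairwise (\<lambda>e e'. L2_inner A e e' = 0) E \<and>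
     (\<forall>f\<in>L2 A. \<forall>\<epsilon>>0. \<exists>F c. finite F \<and> F \<subseteq> E \<and> L2_norm A (\<lambda>x. f x - (\<Sum>e\<in>F. c e * e x)) < \<epsilon>)"

definition spectral :: "'a::ab_group_add set \<Rightarrow> bool" where
  "spectral A \<longleftrightarrow>
     (\<exists>S. (\<forall>h\<in>S. group_character h) \<and> inj_on (\<lambda>h. restrict h A) S \<and>
          orthogonal_basis A ((\<lambda>h. restrict h A) ` S))"

lemma inj_real_vec: "inj real_vec"
  by (auto simp: inj_def real_vec_def vec_eq_iff)

lemma general_linear_position_iff_not_affine_dependent:
  fixes A :: "(int ^ 'd) set"
  assumes fin: "finite A" and ne: "A \<noteq> {}" and le: "card A \<le> CARD('d) + 1"
  shows "general_linear_position A \<longleftrightarrow> \<not> affine_dependent (real_vec ` A)"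
proof -
  let ?X = "real_vec ` A"
  have cX: "card ?X = card A"
    by (rule card_image) (rule inj_on_subset[OF inj_real_vec], simp)
  have cpos: "card A > 0" using fin ne by (simp add: card_gt_0_iff)
  show ?thesis
  proof
    assume g: "general_linear_position A"
    show "\<not> affine_dependent ?X"
    proof
      assume dep: "affine_dependent ?X"
      obtain B where B: "\<not> affine_dependent B" "B \<subseteq> ?X" "affine hull B = affine hull ?X"
        using affine_basis_exists[of ?X] by blast
      have finX: "finite ?X" using fin by simp
      have "B \<noteq> ?X" using B dep by auto
      then have "card B < card ?X" using B(2) finX by (simp add: psubset_card_mono psubset_eq)
      then have cB: "card B \<le> card A - 1" using cX by simp
      obtain C where C: "\<not> affine_dependent C" "B \<subseteq> C" "affine hull C = affine hull UNIV"
        using extend_to_affine_basis[OF B(1), of UNIV] by auto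
      have "int (card C) = aff_dim (UNIV :: (real ^ 'd) set) + 1"
        using C aff_dim_unique[of C UNIV] by simp
      then have cC: "card C = CARD('d) + 1" by (simp)
      have finC: "finite C" using C(1) by (rule aff_independent_finite)
      have "card A - 1 \<le> card C" using cC le by simp
      then obtain D where D: "B \<subseteq> D" "D \<subseteq> C" "card D = card A - 1"
        using exists_subset_between[OF cB _ C(2) finC] by blast
      have "\<not> affine_dependent D" using C(1) D(2) affine_independent_subset by blast
      then have "aff_dim (affine hull D) = int (card A) - 2"
        using aff_dim_affine_independent[of D] D(3) cpos by simp
      moreover have "?X \<subseteq> affine hull D"
        using B(3) D(1) hull_mono[of B D affine] hull_subset[of ?X affine] by auto
      ultimately show False using g unfolding general_linear_position_def
        by (metis affine_affine_hull)
    qed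
  next
    assume ind: "\<not> affine_dependent ?X"
    show "general_linear_position A"
      unfolding general_linear_position_def
    proof clarify
      fix H :: "(real ^ 'd) set"
      assume "aff_dim H = int (card A) - 2" "?X \<subseteq> H"
      then show False
        using aff_dim_subset[of ?X H] aff_dim_affine_independent[OF ind] cX by simp
    qed
  qed
qed

theorem general_linear_position_iff_independent:
  fixes A :: "(int ^ 'd) set"
  assumes "finite A" and "card A \<le> CARD('d) + 1" and a: "a \<in> A"
  shows "general_linear_position A \<longleftrightarrow>
    independent ((\<lambda>v. real_vec v - real_vec a) ` (A - {a}))"
proof -
  have eq: "(\<lambda>v. real_vec v - real_vec a) ` (A - {a}) =
      (\<lambda>x. - real_vec a + x) ` (real_vec ` A - {real_vec a})"
    using inj_real_vec by (auto simp: inj_def image_iff)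
  show ?thesis
    using general_linear_position_iff_not_affine_dependent[of A] assms
      affine_dependent_iff_dependent2[of "real_vec a" "real_vec ` A"]
    unfolding eq by auto
qed

end

(* By linear independence of the differences there is a linear functional h on the ambient real
   space that takes p consecutive values c, c + 1, ..., c + p - 1 on A. Modulo p these values form a
   coset of Z/pZ in R/pZ, so the points x for which the integer part of h x is divisible by p form a
   tiling complement, and the characters x |-> exp(2 pi i k h(x) / p) with k < p restrict on A to the
   characters of Z/pZ, up to scalars of modulus one. *)

theory Submission
  imports Defs
begin

lemma general_linear_position_imp_enumerating_functional:
  fixes A :: "(int ^ 'd) set"
  assumes "finite A" "A \<noteq> {}" "card A \<le> CARD('d) + 1" "general_linear_position A"
  obtains h :: "int ^ 'd \<Rightarrow> real" and c :: real and idx :: "int ^ 'd \<Rightarrow> nat"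
  where "Modules.additive h" "bij_betw idx A {..<card A}" "\<And>a. a \<in> A \<Longrightarrow> h a = c + real (idx a)"
proof -
  obtain a0 where a0: "a0 \<in> A" using assms by blast
  obtain idx where idx: "bij_betw idx A {..<card A}"
    using ex_bij_betw_finite_nat[OF assms(1)] atLeast0LessThan by metis
  let ?V = "(\<lambda>v. real_vec v - real_vec a0) ` (A - {a0})"
  have "independent ?V"
    using general_linear_position_iff_independent[OF assms(1,3) a0] assms(4) by simp
  \<comment> \<open>A functional may be prescribed freely on the independent set \<open>?V\<close>.
    Since \<open>real_vec\<close> is injective, a difference \<open>w\<close> determines its
    endpoint, whose index relative to that of \<open>a0\<close> is the value imposed.\<close>
  from linear_independent_extend[OF this,
      of "\<lambda>w. real (idx (inv real_vec (w + real_vec a0))) - real (idx a0)"]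
  obtain g :: "real ^ 'd \<Rightarrow> real" where g: "linear g"
    "\<forall>w\<in>?V. g w = real (idx (inv real_vec (w + real_vec a0))) - real (idx a0)"
    by blast
  have diff: "g (real_vec a) - g (real_vec a0) = real (idx a) - real (idx a0)" if "a \<in> A" for a
  proof (cases "a = a0")
    case False
    then have "g (real_vec a - real_vec a0) = real (idx a) - real (idx a0)"
      using g(2) that by (auto simp: inv_f_f[OF inj_real_vec])
    then show ?thesis by (simp add: linear_diff[OF g(1)])
  qed simp
  have "real_vec (x + y) = real_vec x + real_vec y" for x y :: "int ^ 'd"
    by (simp add: real_vec_def vec_eq_iff)
  then have add: "Modules.additive (\<lambda>x. g (real_vec x))"
    by (simp add: Modules.additive_def linear_add[OF g(1)])
  show ?thesis
    \<comment> \<open>The offset \<open>c\<close> absorbs the uncontrolled value of \<open>g\<close>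
      at the base point.\<close>
    by (rule that[OF add idx, of "g (real_vec a0) - real (idx a0)"]) (use diff in force)
qed

text \<open>For each \<open>x\<close>, the integers \<open>\<lfloor>h (x - a)\<rfloor>\<close> with
  \<open>a\<close> in \<open>A\<close> run through every residue modulo \<open>n\<close> exactly
  once, so exactly one \<open>a\<close> has \<open>x - a\<close> in \<open>B\<close>. As
  \<open>h\<close> is real-valued and the floor is not additive, \<open>B\<close> need not be a
  subgroup.\<close>

lemma tiling_if_additive_enumerates:
  fixes h :: "'a::ab_group_add \<Rightarrow> real"
  assumes "Modules.additive h" "n > 0" "bij_betw idx A {..<n}" "\<And>a. a \<in> A \<Longrightarrow> h a = c + real (idx a)"
  shows "tiling A"
proof -
  interpret Modules.additive h by fact
  define B where "B = {x. \<lfloor>h x\<rfloor> mod int n = 0}"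
  define r where "r x = nat (\<lfloor>h x - c\<rfloor> mod int n)" for x
  have r_less: "r x < n" for x using assms(2) by (simp add: r_def nat_less_iff)
  \<comment> \<open>The floor does commute with the integer shift by \<open>idx a\<close>; hence
    \<open>r x\<close> is the index of the only point that can carry \<open>x\<close>. Uniqueness of
    that point gives disjointness below, existence gives covering.\<close>
  have mem_B: "x - a \<in> B \<longleftrightarrow> idx a = r x" if "a \<in> A" for a x
  proof -
    have lt: "idx a < n" using assms(3) that by (auto simp: bij_betw_def)
    have "h (x - a) = h x - c - of_int (int (idx a))" using assms(4)[OF that] by (simp add: diff)
    then have "\<lfloor>h (x - a)\<rfloor> = \<lfloor>h x - c\<rfloor> - int (idx a)" by linarith
    then have "x - a \<in> B \<longleftrightarrow> \<lfloor>h x - c\<rfloor> mod int n = int (idx a) mod int n"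
      by (simp add: B_def mod_eq_dvd_iff dvd_eq_mod_eq_0)
    also have "\<dots> \<longleftrightarrow> idx a = r x" using lt by (auto simp: r_def)
    finally show ?thesis .
  qed
  show ?thesis unfolding tiling_def
  proof (intro exI conjI)
    show "disjoint_family_on (\<lambda>b. (\<lambda>a. a + b) ` A) B"
      unfolding disjoint_family_on_def
    proof (intro ballI impI, rule ccontr)
      fix b b' assume bb: "b \<in> B" "b' \<in> B" "b \<noteq> b'"
        "(\<lambda>a. a + b) ` A \<inter> (\<lambda>a. a + b') ` A \<noteq> {}"
      then obtain a a' where a: "a \<in> A" "a' \<in> A" "a + b = a' + b'" by auto
      have "a + b - a = b" "a + b - a' = b'" using a(3) by (simp_all add: algebra_simps)
      then have "idx a = idx a'" using mem_B[of a "a + b"] mem_B[of a' "a + b"] a bb by metis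
      then have "a = a'" using assms(3) a by (auto simp: bij_betw_def inj_on_def)
      then show False using a bb by simp
    qed
    show "(\<Union>b\<in>B. (\<lambda>a. a + b) ` A) = UNIV"
    proof (intro equalityI subset_UNIV subsetI)
      fix x
      have "r x \<in> idx ` A" using r_less assms(3) by (simp add: bij_betw_def)
      then obtain a where a: "a \<in> A" "idx a = r x" by auto
      then have "x - a \<in> B" "x = a + (x - a)" using mem_B by auto
      then show "x \<in> (\<Union>b\<in>B. (\<lambda>a. a + b) ` A)" using a(1) by blast
    qed
  qed
qed

text \<open>A geometric sum whose ratio \<open>?z\<close> satisfies \<open>?z ^ n = 1\<close>: it
  vanishes unless the ratio is 1. It serves twice below, summed over points and summed over
  frequencies.\<close>

lemma sum_roots_of_unity:
  assumes "n > 0"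
  shows "(\<Sum>j<n. cis (2 * pi * of_int m * real j / real n)) = (if int n dvd m then of_nat n else 0)"
proof -
  let ?z = "cis (2 * pi * of_int m / real n)"
  have pow: "cis (2 * pi * of_int m * real j / real n) = ?z ^ j" for j
    unfolding Complex.DeMoivre by (rule arg_cong[of _ _ cis]) simp
  have one: "?z = 1 \<longleftrightarrow> int n dvd m"
  proof -
    have "?z = 1 \<longleftrightarrow> (\<exists>k::int. 2 * pi * of_int m / real n = of_int k * (2 * pi))"
      by (simp only: cis_conv_exp exp_eq_1) (simp add: mult_ac)
    also have "\<dots> \<longleftrightarrow> (\<exists>k::int. real_of_int m = of_int (int n * k))"
      using assms by (simp add: field_simps)
    also have "\<dots> \<longleftrightarrow> int n dvd m" unfolding dvd_def of_int_eq_iff ..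
    finally show ?thesis .
  qed
  have "?z ^ n = 1" using assms by (simp add: Complex.DeMoivre cis_multiple_2pi)
  then show ?thesis unfolding pow using one by (auto simp: geometric_sum)
qed

text \<open>Up to a phase in each row, the matrix of values \<open>e k a\<close> is the
  \<open>n\<close> by \<open>n\<close> Fourier matrix. Its rows are orthogonal
  (\<open>inner\<close>), which gives orthogonality of the characters; its columns are orthogonal
  (\<open>dual\<close>), which gives completeness.\<close>

lemma spectral_if_additive_enumerates:
  fixes h :: "'a::ab_group_add \<Rightarrow> real"
  assumes "Modules.additive h" "n > 0" "bij_betw idx A {..<n}" "\<And>a. a \<in> A \<Longrightarrow> h a = c + real (idx a)"
  shows "spectral A"
proof -
  interpret Modules.additive h by fact
  have fin: "finite A" using assms(3) bij_betw_finite by blast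
  define \<psi> where "\<psi> k x = cis (2 * pi * real k * h x / real n)" for k :: nat and x
  define e where "e k = restrict (\<psi> k) A" for k
  have dvd_iff: "int n dvd int k - int l \<longleftrightarrow> k = l" if "k < n" "l < n" for k l
    using that by (simp add: mod_eq_dvd_iff[symmetric])
  have inner: "(\<Sum>a\<in>A. e k a * cnj (e l a)) = (if k = l then of_nat n else 0)"
    if "k < n" "l < n" for k l
  proof -
    \<comment> \<open>The offset \<open>c\<close> contributes only this factor, which is the same at
      all points of \<open>A\<close> and equals 1 when \<open>k = l\<close>.\<close>
    let ?w = "cis (2 * pi * of_int (int k - int l) * c / real n)"
    have "(\<Sum>a\<in>A. e k a * cnj (e l a)) =
        (\<Sum>a\<in>A. ?w * cis (2 * pi * of_int (int k - int l) * real (idx a) / real n))"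
      by (rule sum.cong)
        (auto simp: e_def \<psi>_def assms(4) cis_cnj cis_mult algebra_simps add_divide_distrib diff_divide_distrib)
    also have "\<dots> = ?w * (\<Sum>j<n. cis (2 * pi * of_int (int k - int l) * real j / real n))"
      unfolding sum_distrib_left[symmetric] by (subst sum.reindex_bij_betw[OF assms(3)]) simp
    also have "\<dots> = (if k = l then of_nat n else 0)"
      unfolding sum_roots_of_unity[OF assms(2)] dvd_iff[OF that] by auto
    finally show ?thesis .
  qed
  \<comment> \<open>Here \<open>c\<close> cancels, because both factors have the same frequency
    \<open>k\<close>.\<close>
  have dual: "(\<Sum>k<n. cnj (e k a) * e k x) = (if a = x then of_nat n else 0)"
    if "a \<in> A" "x \<in> A" for a x
  proof -
    have lt: "idx x < n" "idx a < n" using assms(3) that by (auto simp: bij_betw_def)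
    have "(\<Sum>k<n. cnj (e k a) * e k x) =
        (\<Sum>k<n. cis (2 * pi * of_int (int (idx x) - int (idx a)) * real k / real n))"
      by (rule sum.cong)
        (use that in \<open>auto simp: e_def \<psi>_def assms(4) cis_cnj cis_mult algebra_simps
            add_divide_distrib diff_divide_distrib\<close>)
    also have "\<dots> = (if a = x then of_nat n else 0)"
      unfolding sum_roots_of_unity[OF assms(2)] dvd_iff[OF lt]
      using assms(3) that by (auto simp: bij_betw_def inj_on_def)
    finally show ?thesis .
  qed
  \<comment> \<open>If \<open>e k = e l\<close> with \<open>k \<noteq> l\<close>, then
    \<open>inner\<close> would make the squared norm of \<open>e k\<close> both \<open>n\<close> and
    0.\<close>
  have inj: "inj_on e {..<n}"
    using inner assms(2) by (intro inj_onI) (metis lessThan_iff of_nat_eq_0_iff less_irrefl)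
  have "orthogonal_basis A (e ` {..<n})"
    unfolding orthogonal_basis_def
  proof (intro conjI ballI allI impI)
    show "e ` {..<n} \<subseteq> L2 A"
      using fin by (auto simp: L2_def e_def integrable_count_space)
    show "L2_norm A u \<noteq> 0" if "u \<in> e ` {..<n}" for u
    proof -
      have "(\<Sum>a\<in>A. (norm (u a))\<^sup>2) = real (card A)" using that by (auto simp: e_def \<psi>_def)
      then show ?thesis
        using assms(2,3) bij_betw_same_card[OF assms(3)]
        by (simp add: L2_norm_def lebesgue_integral_count_space_finite[OF fin])
    qed
    show "pairwise (\<lambda>u v. L2_inner A u v = 0) (e ` {..<n})"
      by (auto simp: pairwise_def L2_inner_def lebesgue_integral_count_space_finite[OF fin] inner)
    fix f :: "'a \<Rightarrow> complex" and \<epsilon> :: real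
    assume "\<epsilon> > 0"
    \<comment> \<open>The Fourier coefficient of \<open>f\<close> along \<open>u\<close>: the inner
      product divided by the squared norm \<open>n\<close>.\<close>
    define w where "w u = (\<Sum>a\<in>A. f a * cnj (u a)) / of_nat n" for u :: "'a \<Rightarrow> complex"
    have expand: "(\<Sum>u\<in>e ` {..<n}. w u * u x) = f x" if "x \<in> A" for x
    proof -
      have "(\<Sum>u\<in>e ` {..<n}. w u * u x) = (\<Sum>k<n. \<Sum>a\<in>A. f a * (cnj (e k a) * e k x)) / of_nat n"
        by (simp add: sum.reindex[OF inj] w_def sum_distrib_left sum_distrib_right sum_divide_distrib mult_ac)
      also have "\<dots> = (\<Sum>a\<in>A. f a * (\<Sum>k<n. cnj (e k a) * e k x)) / of_nat n"
        by (subst sum.swap) (simp add: sum_distrib_left)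
      also have "\<dots> = (\<Sum>a\<in>A. if a = x then f a * of_nat n else 0) / of_nat n"
        using that by (intro arg_cong2[where f = "(/)"] sum.cong) (auto simp: dual)
      also have "\<dots> = f x" using that fin assms(2) by simp
      finally show ?thesis .
    qed
    \<comment> \<open>The expansion is exact on \<open>A\<close>, so a single finite sum works for
      every \<open>\<epsilon>\<close>.\<close>
    have "L2_norm A (\<lambda>x. f x - (\<Sum>u\<in>e ` {..<n}. w u * u x)) = 0"
      by (simp add: L2_norm_def lebesgue_integral_count_space_finite[OF fin] expand)
    then show "\<exists>F c. finite F \<and> F \<subseteq> e ` {..<n} \<and> L2_norm A (\<lambda>x. f x - (\<Sum>u\<in>F. c u * u x)) < \<epsilon>"
      using \<open>\<epsilon> > 0\<close> by (intro exI[of _ "e ` {..<n}"] exI[of _ w]) simp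
  qed
  moreover have "(\<lambda>g. restrict g A) ` \<psi> ` {..<n} = e ` {..<n}"
    by (simp add: image_image e_def)
  moreover have "inj_on (\<lambda>g. restrict g A) (\<psi> ` {..<n})"
    using inj by (auto simp: inj_on_def e_def)
  moreover have "group_character (\<psi> k)" for k
    by (simp add: group_character_def \<psi>_def cis_mult add distrib_left add_divide_distrib)
  ultimately show ?thesis
    unfolding spectral_def by (intro exI[of _ "\<psi> ` {..<n}"]) auto
qed

theorem theorem2:
  fixes p :: nat and A :: "(int ^ 'd) set"
  assumes "prime p" and "CARD('d) \<ge> p - 1" and "card A = p" and "general_linear_position A"
  shows "tiling A \<and> spectral A"
proof -
  have "p > 0" using assms(1) by (rule prime_gt_0_nat)
  \<comment> \<open>\<open>card\<close> is 0 on infinite sets, so a positive cardinality forces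
    finiteness. The bound on \<open>p\<close> becomes the one under which general position amounts
    to independence of differences.\<close>
  then have "finite A" "A \<noteq> {}" "card A \<le> CARD('d) + 1"
    using assms(2,3) by (auto intro: card_ge_0_finite)
  then obtain h c idx where "Modules.additive h" "bij_betw idx A {..<p}" "\<And>a. a \<in> A \<Longrightarrow> h a = c + real (idx a)"
    using general_linear_position_imp_enumerating_functional assms(3,4) by metis
  then show ?thesis
    using tiling_if_additive_enumerates spectral_if_additive_enumerates \<open>p > 0\<close> by metis
qed

end
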